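(* Let $q$ and $q+2$ be prime powers with $q\equiv3\pmod 4$, and let $E$ be a skew Hadamard difference set in $(\mathbb{F}_q,+)$. Let $\chi$ be the quadratic character of $\mathbb{F}_{q+2}^*$. Then the set $$D=\{(x,y)\mid x\in E,\ y\in\mathbb{F}_{q+2}^*,\ \chi(y)=1\}\cup\{(x,y)\mid x\in -E,\ y\in\mathbb{F}_{q+2}^*,\ \chi(y)=-1\}\cup\{(x,0)\mid x\in\mathbb{F}_q\}$$ is a $(4n-1,2n-1,n-1)$ difference set in $(\mathbb{F}_q,+)\times(\mathbb{F}_{q+2},+)$, where $n=\frac{(q+1)^2}{4}$.
   Context: A $k$-subset $D$ of a finite abelian group $G$ (written additively) of order $v$ is a $(v,k,\lambda)$ difference set if every nonzero element of $G$ is represented exactly $\lambda$ times as $x-y$ with $x,y\in D$, $x\ne y$. A difference set $E$ in $(\mathbb{F}_q,+)$ is skew Hadamard if $\mathbb{F}_q$ is the disjoint union of $E$, $-E$ and $\{0\}$. *)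

theory Defs
  imports "HOL-Library.Cardinality" "HOL-Library.Product_Plus"
    "HOL-Number_Theory.Cong" "HOL-Number_Theory.Prime_Powers"
begin

definition difference_set ::
    "'g::{ab_group_add, finite} set \<Rightarrow> nat \<Rightarrow> nat \<Rightarrow> nat \<Rightarrow> bool" where
  "difference_set D v k l \<longleftrightarrow>
     CARD('g) = v \<and> card D = k \<and>
     (\<forall>g. g \<noteq> 0 \<longrightarrow> card {(x, y). x \<in> D \<and> y \<in> D \<and> x \<noteq> y \<and> x - y = g} = l)"

definition skew_hadamard_difference_set :: "'a::{field, finite} set \<Rightarrow> bool" where
  "skew_hadamard_difference_set E \<longleftrightarrow>
     (\<exists>v k l. difference_set E v k l) \<and>
     E \<union> uminus ` E \<union> {0} = UNIV \<and>
     E \<inter> uminus ` E = {} \<and> 0 \<notin> E \<and> 0 \<notin> uminus ` E"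

text \<open>The quadratic character is a character of the multiplicative group; the value at
  0 is only the customary extension.\<close>

definition quadratic_character :: "'b::field \<Rightarrow> int" where
  "quadratic_character y =
     (if y = 0 then 0 else if \<exists>z. y = z\<^sup>2 then 1 else - 1)"

end

theory Submission
  imports Defs "HOL-Computational_Algebra.Nth_Powers" "HOL-Library.Disjoint_Sets"
    "HOL-Library.Z2" "HOL-Number_Theory.Residues"
begin

text \<open>
  Let \<open>s\<close> be 1 on \<open>E\<close>, -1 on \<open>-E\<close> and 0 at 0. Both \<open>s\<close> and \<open>\<chi>\<close> are \<open>\<plusminus>1\<close>-valued off 0, vanish
  at 0, have sum 0 and constant autocorrelation off 0: for \<open>s\<close> because \<open>E\<close> is a difference set,
  for \<open>\<chi>\<close> because multiplication by \<open>h\<close> carries shift 1 to shift \<open>h\<close>. Summing over all shifts,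
  the constant must be -1. The \<open>\<plusminus>1\<close>-indicator of \<open>D\<close> is \<open>s \<otimes> \<chi> + 1 \<otimes> \<delta> + \<delta> \<otimes> (\<delta> - 1)\<close>, and
  correlations of tensor products factorise. The only terms of its autocorrelation at \<open>(g, h)\<close>
  that do not just depend on whether \<open>g = 0\<close> and \<open>h = 0\<close> are \<open>s(g) \<chi>(h) + s(-g) \<chi>(-h)\<close>, which
  vanish since \<open>s\<close> is odd and, as \<open>q + 2 \<equiv> 1 (mod 4)\<close>, \<open>\<chi>\<close> is even.
\<close>

section \<open>Correlations on finite abelian groups\<close>

definition corr ::
    "('g::{ab_group_add, finite} \<Rightarrow> 'r::comm_ring_1) \<Rightarrow> ('g \<Rightarrow> 'r) \<Rightarrow> 'g \<Rightarrow> 'r" where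
  "corr f f' g = (\<Sum>x\<in>UNIV. f (x + g) * f' x)"

definition delta :: "'g::zero \<Rightarrow> 'r::zero_neq_one" where
  "delta x = of_bool (x = 0)"

definition tensor :: "('g \<Rightarrow> 'r::times) \<Rightarrow> ('h \<Rightarrow> 'r) \<Rightarrow> 'g \<times> 'h \<Rightarrow> 'r" where
  "tensor f f' = (\<lambda>(x, y). f x * f' y)"

lemma sum_translate_UNIV:
  fixes f :: "'g::{ab_group_add, finite} \<Rightarrow> 'r::comm_monoid_add"
  shows "(\<Sum>x\<in>UNIV. f (x + g)) = sum f UNIV"
  by (rule sum.reindex_bij_witness[of _ "\<lambda>x. x - g" "\<lambda>x. x + g"]) auto

lemma sum_odd_eq_0:
  fixes f :: "'g::{ab_group_add, finite} \<Rightarrow> 'r::{idom, ring_char_0}"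
  assumes "\<And>x. f (- x) = - f x"
  shows "sum f UNIV = 0"
proof -
  have "sum f UNIV = (\<Sum>x\<in>UNIV. f (- x))"
    by (rule sum.reindex_bij_witness[of _ uminus uminus]) auto
  then show ?thesis by (simp add: assms sum_negf)
qed

lemma corr_add_left: "corr (\<lambda>x. f x + f' x) k g = corr f k g + corr f' k g"
  and corr_add_right: "corr k (\<lambda>x. f x + f' x) g = corr k f g + corr k f' g"
  and corr_diff_left: "corr (\<lambda>x. f x - f' x) k g = corr f k g - corr f' k g"
  and corr_diff_right: "corr k (\<lambda>x. f x - f' x) g = corr k f g - corr k f' g"
  by (simp_all add: corr_def algebra_simps sum.distrib sum_subtractf)

lemmas corr_bilinear = corr_add_left corr_add_right corr_diff_left corr_diff_right

lemma corr_scale_left: "corr (\<lambda>x. c * f x) k g = c * corr f k g"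
  and corr_scale_right: "corr k (\<lambda>x. c * f x) g = c * corr k f g"
  by (simp_all add: corr_def sum_distrib_left mult_ac)

lemma corr_const_left: "corr (\<lambda>x. c) k g = c * sum k UNIV"
  by (simp add: corr_def sum_distrib_left)

lemma corr_const_right: "corr k (\<lambda>x. c) g = c * sum k UNIV"
  by (simp add: corr_def sum_translate_UNIV mult.commute flip: sum_distrib_left)

lemma corr_delta_left: "corr delta k g = k (- g)"
proof -
  have "UNIV \<inter> {x. x + g = 0} = {- g}"
    by (auto simp: eq_neg_iff_add_eq_0)
  then show ?thesis by (simp add: corr_def delta_def)
qed

lemma corr_delta_right: "corr k delta g = k g"
  by (simp add: corr_def delta_def)

lemma delta_uminus: "delta (- x) = delta (x :: 'g::group_add)"
  by (simp add: delta_def)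

lemma sum_delta_UNIV: "sum delta (UNIV :: 'g::{zero, finite} set) = (1 :: 'r::semiring_1)"
  by (simp add: delta_def)

lemma sum_corr: "(\<Sum>g\<in>UNIV. corr f f' g) = sum f UNIV * sum f' UNIV"
proof -
  have "(\<Sum>g\<in>UNIV. corr f f' g) = (\<Sum>x\<in>UNIV. \<Sum>g\<in>UNIV. f (x + g) * f' x)"
    unfolding corr_def by (rule sum.swap)
  also have "\<dots> = (\<Sum>x\<in>UNIV. sum f UNIV * f' x)"
    using sum_translate_UNIV[of f] by (simp add: add.commute flip: sum_distrib_right)
  finally show ?thesis by (simp flip: sum_distrib_left)
qed

lemma sum_tensor:
  fixes f :: "'g::finite \<Rightarrow> 'r::semiring_0" and f' :: "'h::finite \<Rightarrow> 'r"
  shows "sum (tensor f f') UNIV = sum f UNIV * sum f' UNIV"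
  by (simp add: tensor_def sum_product sum.cartesian_product)

lemma corr_tensor: "corr (tensor f k) (tensor f' k') (g, h) = corr f f' g * corr k k' h"
proof -
  have "corr (tensor f k) (tensor f' k') (g, h) =
      sum (tensor (\<lambda>x. f (x + g) * f' x) (\<lambda>y. k (y + h) * k' y)) UNIV"
    unfolding corr_def by (rule sum.cong) (auto simp: tensor_def mult_ac)
  then show ?thesis by (simp add: sum_tensor corr_def)
qed

section \<open>Perfect ternary functions\<close>

definition perfect_ternary :: "('g::{ab_group_add, finite} \<Rightarrow> int) \<Rightarrow> bool" where
  "perfect_ternary f \<longleftrightarrow>
     (\<forall>x. (f x)\<^sup>2 = 1 - delta x) \<and> sum f UNIV = 0 \<and>
     (\<forall>g. corr f f g = int CARD('g) * delta g - 1)"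

lemma perfect_ternary_cases:
  assumes "perfect_ternary f"
  obtains "x = 0" "f x = 0" | "x \<noteq> 0" "f x = 1" | "x \<noteq> 0" "f x = - 1"
proof -
  have "(f x)\<^sup>2 = 1 - delta x"
    using assms by (simp add: perfect_ternary_def)
  then show thesis
    using that by (cases "x = 0") (auto simp: delta_def power2_eq_1_iff)
qed

lemma perfect_ternaryI:
  fixes f :: "'g::{ab_group_add, finite} \<Rightarrow> int"
  assumes square: "\<And>x. (f x)\<^sup>2 = 1 - delta x"
    and sum: "sum f UNIV = 0"
    and const: "\<And>g. g \<noteq> 0 \<Longrightarrow> corr f f g = c"
  shows "perfect_ternary f"
proof -
  have corr_0: "corr f f 0 = int CARD('g) - 1"
    by (simp add: corr_def square sum_subtractf sum_delta_UNIV flip: power2_eq_square)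
  have "corr f f g = - 1" if "g \<noteq> 0" for g
  proof -
    have "0 = (\<Sum>g\<in>UNIV. corr f f g)" by (simp add: sum_corr sum)
    also have "\<dots> = corr f f 0 + (\<Sum>g\<in>UNIV - {0}. corr f f g)"
      by (rule sum.remove) auto
    also have "(\<Sum>g\<in>UNIV - {0}. corr f f g) = (int CARD('g) - 1) * c"
      by (simp add: const of_nat_diff)
    also have "corr f f 0 + (int CARD('g) - 1) * c = (int CARD('g) - 1) * (c + 1)"
      by (simp add: corr_0 algebra_simps)
    finally have "(int CARD('g) - 1) * (c + 1) = 0" by simp
    moreover have "CARD('g) > 1"
      using card_mono[of UNIV "{0, g}"] that by simp
    ultimately show ?thesis using const[OF that] by simp
  qed
  then show ?thesis
    using square sum corr_0 by (auto simp: perfect_ternary_def delta_def)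
qed

lemma perfect_ternary_if_multiplicative:
  fixes \<phi> :: "'b::{field, finite} \<Rightarrow> int"
  assumes square: "\<And>x. (\<phi> x)\<^sup>2 = 1 - delta x" and sum: "sum \<phi> UNIV = 0"
    and mult: "\<And>x y. \<phi> (x * y) = \<phi> x * \<phi> y"
  shows "perfect_ternary \<phi>"
proof (rule perfect_ternaryI[OF square sum])
  fix h :: 'b
  assume "h \<noteq> 0"
  have "corr \<phi> \<phi> h = (\<Sum>y\<in>UNIV. \<phi> (h * y + h) * \<phi> (h * y))"
    unfolding corr_def
    by (rule sum.reindex_bij_witness[of _ "\<lambda>y. h * y" "\<lambda>y. y / h"]) (use \<open>h \<noteq> 0\<close> in auto)
  also have "\<dots> = (\<Sum>y\<in>UNIV. (\<phi> h)\<^sup>2 * (\<phi> (y + 1) * \<phi> y))"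
  proof (rule sum.cong)
    fix y
    have "\<phi> (h * y + h) = \<phi> h * \<phi> (y + 1)"
      using mult[of h "y + 1"] by (simp add: distrib_left)
    then show "\<phi> (h * y + h) * \<phi> (h * y) = (\<phi> h)\<^sup>2 * (\<phi> (y + 1) * \<phi> y)"
      by (simp add: mult power2_eq_square mult_ac)
  qed simp
  finally show "corr \<phi> \<phi> h = corr \<phi> \<phi> 1"
    using \<open>h \<noteq> 0\<close> by (simp add: square delta_def corr_def)
qed

section \<open>Difference sets\<close>

definition pm_indicator :: "'g set \<Rightarrow> 'g \<Rightarrow> int" where
  "pm_indicator D x = (if x \<in> D then 1 else - 1)"

lemma pm_indicator_conv_of_bool: "pm_indicator D = (\<lambda>x. 2 * of_bool (x \<in> D) - 1)"
  by (auto simp: pm_indicator_def)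

lemma sum_pm_indicator:
  "sum (pm_indicator D) UNIV = 2 * int (card D) - int CARD('g)" for D :: "'g::finite set"
  by (simp add: pm_indicator_conv_of_bool sum_subtractf flip: sum_distrib_left)

lemma card_differences_eq:
  fixes D :: "'g::{ab_group_add, finite} set"
  assumes "g \<noteq> 0"
  shows "card {(x, y). x \<in> D \<and> y \<in> D \<and> x \<noteq> y \<and> x - y = g} = card {x. x + g \<in> D \<and> x \<in> D}"
  by (rule bij_betw_same_card[OF bij_betw_byWitness[of _ "\<lambda>x. (x + g, x)" snd]])
    (use assms in \<open>auto simp: algebra_simps\<close>)

lemma corr_pm_indicator:
  fixes D :: "'g::{ab_group_add, finite} set"
  shows "corr (pm_indicator D) (pm_indicator D) g =
    4 * int (card {x. x + g \<in> D \<and> x \<in> D}) - 4 * int (card D) + int CARD('g)"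
proof -
  let ?i = "\<lambda>x. of_bool (x \<in> D) :: int"
  have "corr ?i ?i g = int (card {x. x + g \<in> D \<and> x \<in> D})"
    by (simp add: corr_def Collect_conj_eq)
  then show ?thesis
    by (simp add: pm_indicator_conv_of_bool corr_bilinear corr_scale_left corr_scale_right
        corr_const_left corr_const_right flip: sum_distrib_left)
qed

lemma difference_set_iff_corr_pm_indicator:
  fixes D :: "'g::{ab_group_add, finite} set"
  shows "difference_set D v k l \<longleftrightarrow> CARD('g) = v \<and> card D = k \<and>
    (\<forall>g. g \<noteq> 0 \<longrightarrow>
      corr (pm_indicator D) (pm_indicator D) g = int v - 4 * (int k - int l))"
  unfolding difference_set_def
  by (auto simp: card_differences_eq corr_pm_indicator)

section \<open>Skew difference sets\<close>

definition skew_set :: "'g::group_add set \<Rightarrow> bool" where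
  "skew_set E \<longleftrightarrow> (\<forall>x. - x \<in> E \<longleftrightarrow> x \<noteq> 0 \<and> x \<notin> E)"

definition skew_sign :: "'g::group_add set \<Rightarrow> 'g \<Rightarrow> int" where
  "skew_sign E x = of_bool (x \<in> E) - of_bool (- x \<in> E)"

lemma uminus_mem_skew_set_iff: "skew_set E \<Longrightarrow> - x \<in> E \<longleftrightarrow> x \<noteq> 0 \<and> x \<notin> E"
  by (simp add: skew_set_def)

lemma zero_notin_skew_set: "skew_set E \<Longrightarrow> 0 \<notin> E"
  using uminus_mem_skew_set_iff[of E 0] by simp

lemma skew_sign_uminus: "skew_sign E (- x) = - skew_sign E x"
  by (simp add: skew_sign_def)

lemma skew_sign_eq_1_iff: "skew_set E \<Longrightarrow> skew_sign E x = 1 \<longleftrightarrow> x \<in> E"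
  by (simp add: skew_sign_def uminus_mem_skew_set_iff)

lemma skew_sign_eq_minus_1_iff: "skew_set E \<Longrightarrow> skew_sign E x = - 1 \<longleftrightarrow> x \<in> uminus ` E"
  using skew_sign_eq_1_iff[of E "- x"] skew_sign_uminus[of E x]
  by (metis image_iff minus_equation_iff)

lemma skew_sign_eq_pm_indicator:
  "skew_set E \<Longrightarrow> skew_sign E = (\<lambda>x. pm_indicator E x + delta x)"
  using zero_notin_skew_set[of E]
  by (auto simp: skew_sign_def uminus_mem_skew_set_iff pm_indicator_def delta_def)

lemma perfect_ternary_skew_sign:
  fixes E :: "'g::{ab_group_add, finite} set"
  assumes skew: "skew_set E" and "difference_set E v k l"
  shows "perfect_ternary (skew_sign E)"
proof (rule perfect_ternaryI)
  show "(skew_sign E x)\<^sup>2 = 1 - delta x" for x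
    using zero_notin_skew_set[OF skew]
    by (auto simp: skew_sign_eq_pm_indicator[OF skew] pm_indicator_def delta_def)
  show "sum (skew_sign E) UNIV = 0"
    by (rule sum_odd_eq_0) (rule skew_sign_uminus)
  fix g :: 'g
  assume "g \<noteq> 0"
  have "pm_indicator E (- g) = - pm_indicator E g"
    using \<open>g \<noteq> 0\<close> by (simp add: pm_indicator_def uminus_mem_skew_set_iff[OF skew])
  then show "corr (skew_sign E) (skew_sign E) g = int v - 4 * (int k - int l)"
    using assms \<open>g \<noteq> 0\<close>
    by (simp add: skew_sign_eq_pm_indicator difference_set_iff_corr_pm_indicator corr_bilinear
        corr_delta_left corr_delta_right delta_uminus delta_def[of g])
qed

lemma skew_hadamard_difference_set_imp_skew_set:
  assumes "skew_hadamard_difference_set E"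
  shows "skew_set E"
proof -
  have "- x \<in> E \<longleftrightarrow> x \<in> uminus ` E" for x
    by (metis image_iff minus_minus)
  then show ?thesis
    using assms unfolding skew_hadamard_difference_set_def skew_set_def by blast
qed

section \<open>The quadratic character of a finite field\<close>

lemma even_card_involution:
  assumes "\<And>x. x \<in> A \<Longrightarrow> f x \<in> A" and "\<And>x. x \<in> A \<Longrightarrow> f (f x) = x"
    and "\<And>x. x \<in> A \<Longrightarrow> f x \<noteq> x"
  shows "even (card A)"
proof -
  have "(\<Sum>x\<in>A. 1 :: bit) = 0"
    by (rule sum_involution_eq_0[of A _ f]) (use assms in auto)
  then have "even (of_nat (card A) :: bit)" by simp
  then show ?thesis by (simp only: even_of_nat_iff)
qed

lemma two_neq_zero_if_odd_card:
  assumes "odd CARD('b::{field, finite})"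
  shows "(2::'b) \<noteq> 0"
proof
  assume "(2::'b) = 0"
  then have "CHAR('b) dvd 2"
    by (simp flip: of_nat_eq_0_iff_char_dvd)
  then have "CHAR('b) = 2"
    using CHAR_not_1[where 'a = 'b] two_is_prime_nat unfolding prime_nat_iff by auto
  with assms CHAR_dvd_CARD[where 'a = 'b] show False by simp
qed

lemma is_square_mult_cancel_left:
  assumes "is_square (x :: 'b::field)" and "x \<noteq> 0"
  shows "is_square (x * y) \<longleftrightarrow> is_square y"
proof
  assume "is_square (x * y)"
  then obtain z w where "x * y = z\<^sup>2" "x = w\<^sup>2"
    using assms(1) by (auto elim!: is_nth_powerE)
  then have "y = (z / w)\<^sup>2"
    using assms(2) by (simp add: power_divide field_simps)
  then show "is_square y" by simp
qed (use assms in \<open>simp add: is_nth_power_mult\<close>)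

definition nonzero_squares :: "'b::field set" where
  "nonzero_squares = {y. y \<noteq> 0 \<and> is_square y}"

lemma quadratic_character_eq:
  "quadratic_character y = (if y = 0 then 0 else if is_square y then 1 else - 1)"
  by (simp add: quadratic_character_def is_nth_power_def)

context
  assumes odd_card: "odd CARD('b::{field, finite})"
begin

lemma card_square_roots:
  assumes "y \<in> (nonzero_squares :: 'b set)"
  shows "card {z. z \<noteq> 0 \<and> z\<^sup>2 = y} = 2"
proof -
  obtain z where z: "y = z\<^sup>2" "z \<noteq> 0"
    using assms by (auto simp: nonzero_squares_def elim: is_nth_powerE)
  then have "{z. z \<noteq> 0 \<and> z\<^sup>2 = y} = {z, - z}"
    by (auto simp: power2_eq_iff)
  moreover have "z \<noteq> - z"
    using two_neq_zero_if_odd_card[OF odd_card] z(2)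
    by (metis add.right_inverse mult_2 mult_eq_0_iff)
  ultimately show ?thesis by simp
qed

lemma card_nonzero_squares: "CARD('b) = 2 * card (nonzero_squares :: 'b set) + 1"
proof -
  have "(\<lambda>z. z\<^sup>2) ` (UNIV - {0}) = (nonzero_squares :: 'b set)"
    by (auto simp: nonzero_squares_def elim: is_nth_powerE)
  then have "card (UNIV - {0::'b}) =
      (\<Sum>y\<in>(nonzero_squares :: 'b set). card {z. z \<noteq> 0 \<and> z\<^sup>2 = y})"
    using sum.image_gen[of "UNIV - {0::'b}" "\<lambda>_. 1::nat" "\<lambda>z. z\<^sup>2"] by simp
  then show ?thesis
    using card_Suc_Diff1[of UNIV "0::'b"] by (simp add: card_square_roots)
qed

lemma is_square_mult_if_nonsquares:
  fixes x y :: 'b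
  assumes "\<not> is_square x" and "\<not> is_square y"
  shows "is_square (x * y)"
proof (rule ccontr)
  assume "\<not> is_square (x * y)"
  let ?N = "{z::'b. \<not> is_square z}"
  have nonzero: "x \<noteq> 0" "y \<noteq> 0" using assms by auto
  have "?N = UNIV - insert 0 nonzero_squares"
    by (auto simp: nonzero_squares_def)
  then have "card ?N = card (nonzero_squares :: 'b set)"
    using card_nonzero_squares by (simp add: card_Diff_subset nonzero_squares_def)
  moreover have "card ((*) x ` nonzero_squares) = card (nonzero_squares :: 'b set)"
    by (rule card_image) (use nonzero in \<open>simp add: inj_on_def\<close>)
  moreover have "(*) x ` nonzero_squares \<subseteq> ?N"
    using assms is_square_mult_cancel_left[of _ x]
    by (auto simp: nonzero_squares_def mult.commute)
  ultimately have "(*) x ` nonzero_squares = ?N"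
    by (intro card_subset_eq) simp_all
  with \<open>\<not> is_square (x * y)\<close> have "x * y \<in> (*) x ` nonzero_squares" by blast
  with assms nonzero show False by (auto simp: nonzero_squares_def)
qed

lemma quadratic_character_mult:
  "quadratic_character (x * y :: 'b) = quadratic_character x * quadratic_character y"
  using is_square_mult_cancel_left[of x y] is_square_mult_cancel_left[of y x]
    is_square_mult_if_nonsquares[of x y]
  by (auto simp: quadratic_character_eq mult.commute)

lemma sum_quadratic_character: "sum quadratic_character (UNIV :: 'b set) = 0"
proof -
  have "sum quadratic_character (UNIV :: 'b set) =
      (\<Sum>y\<in>UNIV. pm_indicator nonzero_squares (y::'b) + delta y)"
    by (rule sum.cong)
      (auto simp: quadratic_character_eq pm_indicator_def nonzero_squares_def delta_def)
  then show ?thesis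
    using card_nonzero_squares by (simp add: sum.distrib sum_pm_indicator sum_delta_UNIV)
qed

end

lemma perfect_ternary_quadratic_character:
  assumes "odd CARD('b::{field, finite})"
  shows "perfect_ternary (quadratic_character :: 'b \<Rightarrow> int)"
proof (rule perfect_ternary_if_multiplicative)
  show "(quadratic_character (x::'b))\<^sup>2 = 1 - delta x" for x
    by (simp add: quadratic_character_eq delta_def)
qed (simp_all add: quadratic_character_mult[OF assms] sum_quadratic_character[OF assms])

text \<open>If -1 were a nonsquare, then 1 would be the only fixed point of inversion on the
  nonzero squares, whose number is even.\<close>

lemma is_square_minus_one:
  assumes "CARD('b::{field, finite}) mod 4 = 1"
  shows "is_square (- 1 :: 'b)"
proof (rule ccontr)
  let ?S = "nonzero_squares :: 'b set"
  assume nonsquare: "\<not> is_square (- 1 :: 'b)"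
  have "even (card (?S - {1}))"
  proof (rule even_card_involution[of _ inverse])
    fix x
    assume x: "x \<in> ?S - {1}"
    then show "inverse x \<in> ?S - {1}"
      by (auto simp: nonzero_squares_def is_nth_power_def simp flip: power_inverse)
    show "inverse x \<noteq> x"
    proof
      assume "inverse x = x"
      then have "x\<^sup>2 = 1"
        using x left_inverse[of x] by (simp add: nonzero_squares_def power2_eq_square)
      with x nonsquare show False by (auto simp: power2_eq_1_iff nonzero_squares_def)
    qed
  qed simp
  moreover have "card ?S = card (?S - {1}) + 1"
    using card_Suc_Diff1[of ?S 1] by (simp add: nonzero_squares_def)
  moreover have "CARD('b) = 2 * card ?S + 1"
    by (rule card_nonzero_squares) (use assms in presburger)
  ultimately show False using assms by presburger
qed

lemma quadratic_character_uminus: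
  assumes "CARD('b::{field, finite}) mod 4 = 1"
  shows "quadratic_character (- y :: 'b) = quadratic_character y"
proof -
  have "quadratic_character (- 1 :: 'b) = 1"
    using is_square_minus_one[OF assms] by (simp add: quadratic_character_eq)
  moreover have "odd CARD('b)" using assms by presburger
  ultimately show ?thesis
    using quadratic_character_mult[OF _, of "- 1" y] by simp
qed

section \<open>The twin construction\<close>

definition axes_sign :: "'g::zero \<times> 'h::zero \<Rightarrow> int" where
  "axes_sign z = tensor (\<lambda>_. 1) delta z + tensor delta (\<lambda>y. delta y - 1) z"

lemma sum_axes_sign:
  "sum axes_sign (UNIV :: ('g::{zero, finite} \<times> 'h::{zero, finite}) set) =
    int CARD('g) + 1 - int CARD('h)"
  by (simp add: axes_sign_def sum.distrib sum_tensor sum_subtractf sum_delta_UNIV)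

lemma corr_axes_sign:
  "corr axes_sign axes_sign (g :: 'g::{ab_group_add, finite}, h :: 'h::{ab_group_add, finite}) =
    int CARD('g) * delta h + 2 * (delta h - 1) + delta g * (delta h - 2 + int CARD('h))"
  by (simp add: axes_sign_def[abs_def] corr_bilinear corr_tensor corr_const_left
      corr_const_right corr_delta_left corr_delta_right sum_delta_UNIV delta_uminus
      sum_subtractf algebra_simps)

lemma corr_tensor_axes_sign:
  assumes "sum s UNIV = 0" and "sum t UNIV = 0"
  shows "corr (tensor s t) axes_sign (g, h) = s g * t h"
    and "corr axes_sign (tensor s t) (g, h) = s (- g) * t (- h)"
  using assms
  by (simp_all add: axes_sign_def[abs_def] corr_bilinear corr_tensor corr_const_left
      corr_const_right corr_delta_left corr_delta_right)

lemma corr_tensor_add_axes_sign: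
  fixes s :: "'g::{ab_group_add, finite} \<Rightarrow> int" and t :: "'h::{ab_group_add, finite} \<Rightarrow> int"
    and z :: "'g \<times> 'h"
  assumes "perfect_ternary s" and "perfect_ternary t"
    and odd: "\<And>x. s (- x) = - s x" and even: "\<And>y. t (- y) = t y"
    and card: "CARD('h) = CARD('g) + 2" and "z \<noteq> 0"
  defines "f \<equiv> \<lambda>z. tensor s t z + axes_sign z"
  shows "corr f f z = - 1"
proof -
  obtain g h where z: "z = (g, h)" by (cases z)
  have zero_sum: "sum s UNIV = 0" "sum t UNIV = 0"
    using assms(1,2) by (simp_all add: perfect_ternary_def)
  have "corr f f z = corr s s g * corr t t h + s g * t h + s (- g) * t (- h)
      + corr axes_sign axes_sign (g, h)"
    by (simp add: z f_def corr_bilinear corr_tensor corr_tensor_axes_sign zero_sum)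
  also have "s (- g) * t (- h) = - (s g * t h)"
    by (simp add: odd even)
  also have "corr s s g * corr t t h =
      (int CARD('g) * delta g - 1) * (int CARD('h) * delta h - 1)"
    using assms(1,2) by (simp add: perfect_ternary_def)
  also have "\<dots> + s g * t h + - (s g * t h) + corr axes_sign axes_sign (g, h) =
      (int CARD('g) * int CARD('h) + 1) * (delta g * delta h) - 1"
    by (simp add: corr_axes_sign card algebra_simps)
  also have "delta g * delta h = (0::int)"
    using \<open>z \<noteq> 0\<close> by (simp add: z delta_def zero_prod_def)
  finally show ?thesis by simp
qed

theorem difference_set_twin:
  fixes s :: "'g::{ab_group_add, finite} \<Rightarrow> int" and t :: "'h::{ab_group_add, finite} \<Rightarrow> int"
  assumes s: "perfect_ternary s" "\<And>x. s (- x) = - s x"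
    and t: "perfect_ternary t" "\<And>y. t (- y) = t y"
    and card: "CARD('h) = CARD('g) + 2" and n: "4 * n = (CARD('g) + 1)\<^sup>2"
  shows "difference_set {(x, y). s x * t y = 1 \<or> y = 0} (4 * n - 1) (2 * n - 1) (n - 1)"
    (is "difference_set ?D _ _ _")
proof -
  have f: "pm_indicator ?D = (\<lambda>z. tensor s t z + axes_sign z)"
  proof (rule ext, clarify)
    fix x y
    show "pm_indicator ?D (x, y) = tensor s t (x, y) + axes_sign (x, y)"
      by (rule perfect_ternary_cases[OF s(1), of x]; rule perfect_ternary_cases[OF t(1), of y])
        (auto simp: pm_indicator_def tensor_def axes_sign_def delta_def)
  qed
  have "n > 0" using n by (cases n) auto
  have v: "CARD('g \<times> 'h) = 4 * n - 1"
    using n by (simp add: card power2_eq_square algebra_simps)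
  have "sum (pm_indicator ?D) UNIV = - 1"
    using s(1) t(1) by (simp add: f sum.distrib sum_tensor sum_axes_sign card perfect_ternary_def)
  with v \<open>n > 0\<close> have "card ?D = 2 * n - 1"
    unfolding sum_pm_indicator by linarith
  moreover have "corr (pm_indicator ?D) (pm_indicator ?D) z = - 1" if "z \<noteq> 0" for z
    unfolding f using s t card that by (intro corr_tensor_add_axes_sign)
  ultimately show ?thesis
    using v \<open>n > 0\<close> by (simp add: difference_set_iff_corr_pm_indicator of_nat_diff)
qed

theorem theorem5p2:
  fixes E :: "'a::{field, finite} set"
    and \<chi> :: "'b::{field, finite} \<Rightarrow> int"
    and D :: "('a \<times> 'b) set"
    and q n :: nat
  assumes "primepow q" and "primepow (q + 2)"
    and "[q = 3] (mod 4)"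
    and "CARD('a) = q" and "CARD('b) = q + 2"
    and "skew_hadamard_difference_set E"
    and "\<chi> = quadratic_character"
    and "D = {(x, y). x \<in> E \<and> y \<noteq> 0 \<and> \<chi> y = 1}
           \<union> {(x, y). x \<in> uminus ` E \<and> y \<noteq> 0 \<and> \<chi> y = - 1}
           \<union> {(x, y). y = 0}"
    and "n = (q + 1)\<^sup>2 div 4"
  shows "difference_set D (4 * n - 1) (2 * n - 1) (n - 1)"
proof -
  have "q mod 4 = 3" using assms(3) by (simp add: cong_def)
  then have card_b: "odd CARD('b)" "CARD('b) mod 4 = 1" and "4 dvd q + 1"
    unfolding assms(5) by presburger+
  have skew: "skew_set E"
    by (rule skew_hadamard_difference_set_imp_skew_set[OF assms(6)])
  have s: "perfect_ternary (skew_sign E)" "\<And>x. skew_sign E (- x) = - skew_sign E x"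
    using perfect_ternary_skew_sign[OF skew] assms(6)
    by (auto simp: skew_hadamard_difference_set_def skew_sign_uminus)
  have t: "perfect_ternary \<chi>" "\<And>y. \<chi> (- y) = \<chi> y"
    using perfect_ternary_quadratic_character[OF card_b(1)]
      quadratic_character_uminus[OF card_b(2)] by (simp_all add: assms(7))
  have "4 dvd (q + 1)\<^sup>2"
    unfolding power2_eq_square using \<open>4 dvd q + 1\<close> by (rule dvd_mult2)
  then have "4 * n = (CARD('a) + 1)\<^sup>2" by (simp add: assms(4,9))
  moreover have "D = {(x, y). skew_sign E x * \<chi> y = 1 \<or> y = 0}"
    unfolding assms(8) zmult_eq_1_iff skew_sign_eq_1_iff[OF skew]
      skew_sign_eq_minus_1_iff[OF skew] by blast
  ultimately show ?thesis
    using difference_set_twin[OF s t] assms(4,5) by simp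
qed

end
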